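(* Let $F$ be a nonsingular unsatisfiable hitting clause-set which is fs-resolvable, and let $F'$ be the result of an fs-resolution on $F$ (so $F'$ is an unsatisfiable hitting clause-set). Then $\mathrm{singind}(F')\le 3$.
   Context: Variables are positive integers, literals are nonzero integers, the complement of $x$ is $\overline{x}=-x$. A clause is a finite set of literals with no pair $x,\overline{x}$; a clause-set is a finite set of clauses. $F$ is satisfiable if some clause meets every clause of $F$, otherwise unsatisfiable. $F$ is hitting if any two distinct clauses $C,D\in F$ have some $x\in C$ with $\overline{x}\in D$. $\mathrm{ldeg}_F(x)$ is the number of clauses containing $x$; a variable $v$ of $F$ is singular if $\min(\mathrm{ldeg}_F(v),\mathrm{ldeg}_F(\overline v))=1$; $F$ is nonsingular if it has none. For a singular variable $v$, singular DP-reduction replaces $F$ by $\mathrm{DP}_v(F):=\{(A\cup B)\setminus\{v,\overline v\}: A,B\in F, A\cap\overline{B}=\{v\}\}\cup\{A\in F: v \text{ does not occur in } A\}$. For an unsatisfiable hitting clause-set $F$, every maximal sequence of singular DP-reductions (ending when no singular variable remains) has the same length, denoted $\mathrm{singind}(F)$. An fs-pair is $\{E\cup\{w\},E\cup\{\overline w\}\}$ with $w,\overline w\notin E$; $F$ is fs-resolvable if it contains an fs-pair $\{E\cup\{w\},E\cup\{\overline w\}\}$ with $E\notin F$, and the fs-resolution replaces these two clauses by $E$. *)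

theory Defs
  imports Main
begin

text \<open>Literals are the nonzero integers, variables the positive integers, and the complement
  of a literal is its negation.\<close>

definition clause :: "int set \<Rightarrow> bool" where
  "clause C \<longleftrightarrow> finite C \<and> 0 \<notin> C \<and> (\<forall>x\<in>C. - x \<notin> C)"

definition clause_set :: "int set set \<Rightarrow> bool" where
  "clause_set F \<longleftrightarrow> finite F \<and> (\<forall>C\<in>F. clause C)"

definition satisfiable :: "int set set \<Rightarrow> bool" where
  "satisfiable F \<longleftrightarrow> (\<exists>P. clause P \<and> (\<forall>C\<in>F. P \<inter> C \<noteq> {}))"

definition hitting :: "int set set \<Rightarrow> bool" where
  "hitting F \<longleftrightarrow> (\<forall>C\<in>F. \<forall>D\<in>F. C \<noteq> D \<longrightarrow> (\<exists>x\<in>C. - x \<in> D))"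

definition unsat_hitting :: "int set set \<Rightarrow> bool" where
  "unsat_hitting F \<longleftrightarrow> clause_set F \<and> \<not> satisfiable F \<and> hitting F"

definition ldeg :: "int set set \<Rightarrow> int \<Rightarrow> nat" where
  "ldeg F x = card {C \<in> F. x \<in> C}"

text \<open>If the minimum is 1 then \<open>v\<close> occurs in \<open>F\<close>, so this need not be required separately.\<close>

definition singular_var :: "int set set \<Rightarrow> int \<Rightarrow> bool" where
  "singular_var F v \<longleftrightarrow> v > 0 \<and> min (ldeg F v) (ldeg F (- v)) = 1"

definition nonsingular :: "int set set \<Rightarrow> bool" where
  "nonsingular F \<longleftrightarrow> (\<nexists>v. singular_var F v)"

definition DP :: "int \<Rightarrow> int set set \<Rightarrow> int set set" where
  "DP v F = {(A \<union> B) - {v, - v} | A B. A \<in> F \<and> B \<in> F \<and> A \<inter> uminus ` B = {v}}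
            \<union> {A \<in> F. v \<notin> A \<and> - v \<notin> A}"

definition singular_DP :: "int set set \<Rightarrow> int set set \<Rightarrow> bool" where
  "singular_DP F G \<longleftrightarrow> (\<exists>v. singular_var F v \<and> G = DP v F)"

text \<open>The common length of all maximal sequences of singular DP-reductions starting in \<open>F\<close>;
  it is meaningful only when this length is unique, as it is for unsatisfiable hitting
  clause-sets.\<close>

definition singind :: "int set set \<Rightarrow> nat" where
  "singind F = (THE n. \<exists>G. (singular_DP ^^ n) F G \<and> nonsingular G)"

definition fs_pair :: "int set \<Rightarrow> int \<Rightarrow> int set set" where
  "fs_pair E w = {insert w E, insert (- w) E}"

definition fs_resolvable_on :: "int set set \<Rightarrow> int set \<Rightarrow> int \<Rightarrow> bool" where
  "fs_resolvable_on F E w \<longleftrightarrow>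
     clause E \<and> w \<noteq> 0 \<and> w \<notin> E \<and> - w \<notin> E \<and> fs_pair E w \<subseteq> F \<and> E \<notin> F"

definition fs_resolvable :: "int set set \<Rightarrow> bool" where
  "fs_resolvable F \<longleftrightarrow> (\<exists>E w. fs_resolvable_on F E w)"

definition fs_resolution :: "int set set \<Rightarrow> int set set \<Rightarrow> bool" where
  "fs_resolution F F' \<longleftrightarrow>
     (\<exists>E w. fs_resolvable_on F E w \<and> F' = insert E (F - fs_pair E w))"

end

theory Submission
  imports Defs
begin

text \<open>Call a literal singular if exactly one clause contains it. In an unsatisfiable hitting
  clause-set \<open>F\<close>, every clause containing the complement of a singular literal \<open>x\<close> includes the
  rest of the clause of \<open>x\<close>. Hence singular DP-reduction on \<open>x\<close> just sets \<open>x\<close> to true, no clause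
  contains two singular literals, and singular DP-reduction has the diamond property, so that all
  its maximal sequences have the same length.

  Setting a singular literal \<open>x\<close> to true removes it from the set of singular literals. New ones
  arise only in the clause of \<open>x\<close>, and only if \<open>- x\<close> was singular as well; then two singular
  literals vanish, and at most one appears, because what is left of the clause of \<open>x\<close> is still a
  clause of the reduced clause-set. So each reduction lowers the number of singular literals, which
  therefore bounds the singularity index. After an fs-resolution of a nonsingular \<open>F\<close> to \<open>E\<close> on
  \<open>w\<close>, the singular literals are among \<open>w\<close>, \<open>- w\<close> and a single literal of \<open>E\<close>.\<close>

section \<open>Reductions with the diamond property\<close>

context
  fixes P :: "'a \<Rightarrow> bool" and r :: "'a \<Rightarrow> 'a \<Rightarrow> bool"
  assumes invariant: "\<And>x y. P x \<Longrightarrow> r x y \<Longrightarrow> P y"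
    and diamond: "\<And>x y z. P x \<Longrightarrow> r x y \<Longrightarrow> r x z \<Longrightarrow> y \<noteq> z \<Longrightarrow> \<exists>u. r y u \<and> r z u"
begin

lemma diamond_relpowp_step:
  assumes "P x" "(r ^^ n) x y" "\<nexists>u. r y u" "r x z"
  shows "\<exists>m. n = Suc m \<and> (r ^^ m) z y"
  using assms
proof (induction n arbitrary: x z)
  case 0
  then show ?case by auto
next
  case (Suc k)
  obtain x' where x': "r x x'" "(r ^^ k) x' y"
    using Suc.prems(2) by (metis relpowp_Suc_E2)
  show ?case
  proof (cases "x' = z")
    case True
    then show ?thesis using x' by blast
  next
    case False
    obtain u where u: "r x' u" "r z u"
      using diamond[OF Suc.prems(1) x'(1) Suc.prems(4) False] by blast
    have "P x'" using invariant Suc.prems(1) x'(1) by blast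
    then obtain j where "k = Suc j" "(r ^^ j) u y"
      using Suc.IH x'(2) Suc.prems(3) u(1) by blast
    then show ?thesis using u(2) by (metis relpowp_Suc_I2)
  qed
qed

lemma diamond_relpowp_length_unique:
  assumes "P x" "(r ^^ n) x y" "\<nexists>u. r y u" "(r ^^ m) x z" "\<nexists>u. r z u"
  shows "n = m"
  using assms
proof (induction m arbitrary: x n)
  case 0
  then have "\<nexists>u. r x u" by simp
  then show ?case
    using "0.prems"(2) by (cases n) (auto dest: relpowp_Suc_D2 simp del: relpowp.simps)
next
  case (Suc m)
  obtain x' where x': "r x x'" "(r ^^ m) x' z"
    using Suc.prems(4) by (metis relpowp_Suc_E2)
  then obtain k where "n = Suc k" "(r ^^ k) x' y"
    using diamond_relpowp_step Suc.prems by blast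
  moreover have "P x'" using invariant Suc.prems(1) x'(1) by blast
  ultimately show ?case using Suc.IH x'(2) Suc.prems(3,5) by blast
qed

end

section \<open>Unsatisfiable hitting clause-sets\<close>

lemma clause_uminus_notin: "clause C \<Longrightarrow> x \<in> C \<Longrightarrow> - x \<notin> C"
  unfolding clause_def by blast

lemma clause_insert:
  assumes "clause C" "x \<noteq> 0" "- x \<notin> C"
  shows "clause (insert x C)"
  using assms unfolding clause_def
  by (metis equation_minus_iff finite_insert insert_iff neg_equal_zero)

lemma clause_flip:
  assumes "clause C" "x \<in> C"
  shows "clause (insert x (uminus ` (C - {x})))"
  using assms unfolding clause_def by force

lemma hitting_clash:
  assumes "hitting F" "C \<in> F" "D \<in> F" "C \<noteq> D"
  obtains x where "x \<in> C" "- x \<in> D"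
  using assms unfolding hitting_def by blast

lemma unsat_hittingD:
  assumes "unsat_hitting F"
  shows "clause_set F" "hitting F"
  using assms unfolding unsat_hitting_def by blast+

lemma unsat_hitting_finite: "unsat_hitting F \<Longrightarrow> finite F"
  unfolding unsat_hitting_def clause_set_def by blast

lemma unsat_hitting_clause: "unsat_hitting F \<Longrightarrow> C \<in> F \<Longrightarrow> clause C"
  unfolding unsat_hitting_def clause_set_def by blast

lemma unsat_hitting_falsified:
  assumes "unsat_hitting F" "clause P"
  obtains B where "B \<in> F" "P \<inter> B = {}"
  using assms unfolding unsat_hitting_def satisfiable_def by blast

lemma falsified_clause_uminus_mem:
  assumes unsat: "unsat_hitting F" and C: "C \<in> F" "x \<in> C"
    and P: "clause P" "insert x (uminus ` (C - {x})) \<subseteq> P"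
  obtains B where "B \<in> F" "P \<inter> B = {}" "- x \<in> B"
proof -
  obtain B where B: "B \<in> F" "P \<inter> B = {}" using unsat_hitting_falsified[OF unsat P(1)] .
  then have "B \<noteq> C" using C P by blast
  then obtain l where l: "l \<in> B" "- l \<in> C"
    using hitting_clash[OF unsat_hittingD(2)[OF unsat] B(1) C(1)] by blast
  have "l \<notin> uminus ` (C - {x})" using l P B by blast
  then have "- l = x" using l by (metis DiffI imageI minus_minus singletonD)
  then have "- x \<in> B" using l by auto
  then show thesis using that B by blast
qed

lemma unsat_hitting_uminus_mem_Union:
  assumes unsat: "unsat_hitting F" and "x \<in> \<Union> F"
  shows "- x \<in> \<Union> F"
proof -
  obtain C where C: "C \<in> F" "x \<in> C" using assms(2) by blast
  then have "clause (insert x (uminus ` (C - {x})))"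
    using clause_flip unsat_hitting_clause[OF unsat] by blast
  then obtain B where "B \<in> F" "- x \<in> B"
    using falsified_clause_uminus_mem[OF unsat C] by blast
  then show ?thesis by blast
qed

section \<open>Singular literals\<close>

definition singular_literals :: "int set set \<Rightarrow> int set" where
  "singular_literals F = {x. ldeg F x = 1}"

lemma singular_literalE:
  assumes "x \<in> singular_literals F"
  obtains C where "C \<in> F" "x \<in> C" "\<And>D. D \<in> F \<Longrightarrow> x \<in> D \<Longrightarrow> D = C"
proof -
  have "card {C \<in> F. x \<in> C} = 1" using assms unfolding singular_literals_def ldeg_def by simp
  then obtain C where "{C \<in> F. x \<in> C} = {C}" by (rule card_1_singletonE)
  then show thesis using that[of C] by blast
qed

lemma singular_literals_subset_Union: "singular_literals F \<subseteq> \<Union> F"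
  by (auto elim: singular_literalE)

lemma finite_singular_literals:
  assumes "clause_set F"
  shows "finite (singular_literals F)"
proof (rule finite_subset[OF singular_literals_subset_Union])
  show "finite (\<Union> F)" using assms unfolding clause_set_def clause_def by blast
qed

lemma singular_literal_nonzero:
  assumes "clause_set F" "x \<in> singular_literals F"
  shows "x \<noteq> 0"
  using assms unfolding clause_set_def clause_def by (metis singular_literalE)

lemma ldeg_pos_iff:
  assumes "finite F"
  shows "ldeg F x > 0 \<longleftrightarrow> x \<in> \<Union> F"
  using assms by (auto simp: ldeg_def card_gt_0_iff)

lemma singular_var_iff:
  assumes unsat: "unsat_hitting F"
  shows "singular_var F v \<longleftrightarrow> v > 0 \<and> (v \<in> singular_literals F \<or> - v \<in> singular_literals F)"
proof -
  have "ldeg F (- x) > 0" if "ldeg F x > 0" for x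
    using that unsat_hitting_uminus_mem_Union[OF unsat]
      ldeg_pos_iff[OF unsat_hitting_finite[OF unsat]] by blast
  from this[of v] this[of "- v"] show ?thesis
    unfolding singular_var_def singular_literals_def by (auto simp: min_def)
qed

lemma singular_var_abs:
  assumes unsat: "unsat_hitting F" and x: "x \<in> singular_literals F"
  shows "singular_var F \<bar>x\<bar>"
  using x singular_literal_nonzero[OF unsat_hittingD(1)[OF unsat] x]
  by (auto simp: singular_var_iff[OF unsat] abs_if)

lemma nonsingular_iff:
  assumes unsat: "unsat_hitting F"
  shows "nonsingular F \<longleftrightarrow> singular_literals F = {}"
  using singular_var_iff[OF unsat] singular_var_abs[OF unsat] unfolding nonsingular_def by blast

lemma singular_clause_subset:
  assumes unsat: "unsat_hitting F" and x: "x \<in> singular_literals F"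
    and C: "C \<in> F" "x \<in> C" and D: "D \<in> F" "- x \<in> D"
  shows "C - {x} \<subseteq> D"
proof (rule ccontr)
  assume "\<not> C - {x} \<subseteq> D"
  then obtain z where z: "z \<in> C" "z \<noteq> x" "z \<notin> D" by blast
  \<comment> \<open>The assignment that makes \<open>- x\<close> the only true literal of \<open>D\<close> and sets \<open>z\<close> to true would
    satisfy \<open>F\<close>.\<close>
  define P where "P = insert (- x) (uminus ` (D - {- x}))"
  have "clause P"
    unfolding P_def using clause_flip[OF unsat_hitting_clause[OF unsat D(1)] D(2)] .
  moreover have "z \<noteq> 0"
    using unsat_hitting_clause[OF unsat C(1)] z(1) unfolding clause_def by blast
  moreover have "- z \<notin> P" unfolding P_def using z by auto
  ultimately have "clause (insert z P)" by (rule clause_insert)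
  then obtain B where B: "B \<in> F" "insert z P \<inter> B = {}" "- (- x) \<in> B"
    using falsified_clause_uminus_mem[OF unsat D] P_def by blast
  then have "B = C" using x C by (metis minus_minus singular_literalE)
  then show False using B(2) z(1) by blast
qed

lemma singular_literals_clause_unique:
  assumes unsat: "unsat_hitting F" and C: "C \<in> F" "x \<in> C" "y \<in> C"
    and x: "x \<in> singular_literals F" and y: "y \<in> singular_literals F"
  shows "x = y"
proof (rule ccontr)
  assume "x \<noteq> y"
  obtain D where D: "D \<in> F" "- x \<in> D" using unsat_hitting_uminus_mem_Union[OF unsat] C by blast
  then have "y \<in> D" using singular_clause_subset[OF unsat x C(1,2)] C(3) \<open>x \<noteq> y\<close> by blast
  then have "D = C" using y C D by (metis singular_literalE)
  then show False using D(2) C clause_uminus_notin unsat_hitting_clause[OF unsat] by blast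
qed

lemma card_singular_literals_Int_clause_le:
  assumes unsat: "unsat_hitting F" and C: "C \<in> F"
  shows "card (singular_literals F \<inter> C) \<le> 1"
proof -
  have "\<forall>x\<in>singular_literals F \<inter> C. \<forall>y\<in>singular_literals F \<inter> C. x = y"
    using singular_literals_clause_unique[OF unsat C] by blast
  then show ?thesis
    using finite_singular_literals[OF unsat_hittingD(1)[OF unsat]]
    by (simp add: card_le_Suc0_iff_eq)
qed

section \<open>Assignments\<close>

definition assign :: "int \<Rightarrow> int set set \<Rightarrow> int set set" where
  "assign x F = (\<lambda>D. D - {- x}) ` {D \<in> F. x \<notin> D}"

lemma Union_assign_Int: "\<Union> (assign x F) \<inter> {x, - x} = {}"
  unfolding assign_def by auto

lemma assign_commute:
  assumes "x \<noteq> - y"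
  shows "assign x (assign y F) = assign y (assign x F)"
proof -
  have assign_assign: "assign u (assign v F) = (\<lambda>D. D - {- u, - v}) ` {D \<in> F. u \<notin> D \<and> v \<notin> D}"
    if "u \<noteq> - v" for u v
  proof -
    have "{D \<in> assign v F. u \<notin> D} = (\<lambda>D. D - {- v}) ` {D \<in> F. u \<notin> D \<and> v \<notin> D}"
      using that unfolding assign_def by blast
    moreover have "D - {- v} - {- u} = D - {- u, - v}" for D by blast
    ultimately show ?thesis unfolding assign_def[of u] by (simp add: image_image)
  qed
  have "y \<noteq> - x" using assms by auto
  then show ?thesis
    using assms by (simp add: assign_assign insert_commute conj_commute)
qed

lemma clause_set_assign: "clause_set F \<Longrightarrow> clause_set (assign x F)"
  unfolding clause_set_def assign_def clause_def by auto

lemma hitting_assign: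
  assumes "hitting F"
  shows "hitting (assign x F)"
  unfolding hitting_def
proof (intro ballI impI)
  fix C D assume "C \<in> assign x F" "D \<in> assign x F" "C \<noteq> D"
  then obtain A B where originals: "A \<in> F" "x \<notin> A" "B \<in> F" "x \<notin> B"
    and restricted: "C = A - {- x}" "D = B - {- x}" unfolding assign_def by blast
  obtain l where l: "l \<in> A" "- l \<in> B"
    using assms \<open>C \<noteq> D\<close> originals restricted unfolding hitting_def by blast
  then have "l \<noteq> - x" "- l \<noteq> - x" using originals by auto
  then show "\<exists>l\<in>C. - l \<in> D" using l restricted by blast
qed

lemma satisfiable_assignD:
  assumes "satisfiable (assign x F)" "x \<noteq> 0"
  shows "satisfiable F"
proof -
  obtain P where P: "clause P" "\<forall>D\<in>assign x F. P \<inter> D \<noteq> {}"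
    using assms(1) unfolding satisfiable_def by blast
  have "clause (P - {- x})" using P(1) unfolding clause_def by blast
  then have "clause (insert x (P - {- x}))" using assms(2) by (simp add: clause_insert)
  moreover have "insert x (P - {- x}) \<inter> B \<noteq> {}" if "B \<in> F" for B
  proof (cases "x \<in> B")
    case False
    then have "B - {- x} \<in> assign x F" using that unfolding assign_def by blast
    then have "P \<inter> (B - {- x}) \<noteq> {}" by (rule bspec[OF P(2)])
    then show ?thesis by blast
  qed simp
  ultimately show ?thesis unfolding satisfiable_def by blast
qed

lemma unsat_hitting_assign: "unsat_hitting F \<Longrightarrow> x \<noteq> 0 \<Longrightarrow> unsat_hitting (assign x F)"
  unfolding unsat_hitting_def using clause_set_assign hitting_assign satisfiable_assignD by blast

lemma inj_on_assign:
  assumes F: "clause_set F" "hitting F"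
  shows "inj_on (\<lambda>D. D - {- x}) {D \<in> F. x \<notin> D}"
proof (rule inj_onI, rule ccontr)
  fix A B assume "A \<in> {D \<in> F. x \<notin> D}" and B: "B \<in> {D \<in> F. x \<notin> D}"
    and eq: "A - {- x} = B - {- x}" and "A \<noteq> B"
  then obtain l where l: "l \<in> A" "- l \<in> B" using hitting_clash[OF F(2)] by blast
  then have "l \<noteq> - x" using B by auto
  then have "l \<in> B" using l eq by blast
  then show False using l B F(1) clause_uminus_notin unfolding clause_set_def by blast
qed

lemma ldeg_assign:
  assumes F: "clause_set F" "hitting F" and y: "y \<noteq> - x"
  shows "ldeg (assign x F) y = card {D \<in> F. x \<notin> D \<and> y \<in> D}"
proof -
  have "{C \<in> assign x F. y \<in> C} = (\<lambda>D. D - {- x}) ` {D \<in> F. x \<notin> D \<and> y \<in> D}"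
    using y unfolding assign_def by auto
  moreover have "inj_on (\<lambda>D. D - {- x}) {D \<in> F. x \<notin> D \<and> y \<in> D}"
    using inj_on_assign[OF F] by (rule inj_on_subset) auto
  ultimately show ?thesis unfolding ldeg_def by (simp add: card_image)
qed

lemma ldeg_assign_outside_clause:
  assumes F: "clause_set F" "hitting F" and x: "x \<in> singular_literals F"
    and C: "C \<in> F" "x \<in> C" and y: "y \<notin> C" "y \<noteq> - x"
  shows "ldeg (assign x F) y = ldeg F y"
proof -
  have "{D \<in> F. x \<notin> D \<and> y \<in> D} = {D \<in> F. y \<in> D}"
    using x C y(1) by (metis singular_literalE)
  then show ?thesis using ldeg_assign[OF F y(2)] unfolding ldeg_def by simp
qed

section \<open>Singular DP-reduction\<close>

lemma DP_uminus: "DP (- v) F = DP v F"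
proof -
  have swap: "A \<inter> uminus ` B = {- v} \<longleftrightarrow> B \<inter> uminus ` A = {v}" for A B :: "int set"
  proof -
    have "B \<inter> uminus ` A = uminus ` (A \<inter> uminus ` B)" by (force simp: image_iff)
    then show ?thesis by (metis image_empty image_insert inj_image_eq_iff inj_uminus minus_minus)
  qed
  show ?thesis unfolding DP_def swap by (auto simp: Un_commute insert_commute)
qed

lemma singular_clause_conflict:
  assumes unsat: "unsat_hitting F" and x: "x \<in> singular_literals F"
    and C: "C \<in> F" "x \<in> C" and D: "D \<in> F"
  shows "C \<inter> uminus ` D = {x} \<longleftrightarrow> - x \<in> D"
proof
  assume "- x \<in> D"
  then have "C - {x} \<subseteq> D" using singular_clause_subset[OF unsat x C D] by blast
  then have "C \<inter> uminus ` D \<subseteq> {x}"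
    using clause_uminus_notin[OF unsat_hitting_clause[OF unsat D]] by force
  moreover have "x \<in> C \<inter> uminus ` D" using C(2) \<open>- x \<in> D\<close> by (force simp: image_iff)
  ultimately show "C \<inter> uminus ` D = {x}" by blast
next
  assume "C \<inter> uminus ` D = {x}"
  then have "x \<in> uminus ` D" by blast
  then show "- x \<in> D" by auto
qed

lemma DP_eq_assign:
  assumes unsat: "unsat_hitting F" and x: "x \<in> singular_literals F"
  shows "DP x F = assign x F"
proof -
  obtain C where C: "C \<in> F" "x \<in> C" and only: "\<And>D. D \<in> F \<Longrightarrow> x \<in> D \<Longrightarrow> D = C"
    using x by (metis singular_literalE)
  note conflict = singular_clause_conflict[OF unsat x C]
  have resolvent: "(C \<union> D) - {x, - x} = D - {- x}" and x_notin: "x \<notin> D"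
    if D: "D \<in> F" "- x \<in> D" for D
  proof -
    show "x \<notin> D" using clause_uminus_notin[OF unsat_hitting_clause[OF unsat]] D by blast
    then show "(C \<union> D) - {x, - x} = D - {- x}"
      using singular_clause_subset[OF unsat x C D] by blast
  qed
  have "A \<in> F \<and> B \<in> F \<and> A \<inter> uminus ` B = {x} \<longleftrightarrow> A = C \<and> B \<in> F \<and> - x \<in> B" for A B
    using only[of A] conflict[of B] C(1) by blast
  then have "{(A \<union> B) - {x, - x} | A B. A \<in> F \<and> B \<in> F \<and> A \<inter> uminus ` B = {x}}
      = {(C \<union> D) - {x, - x} | D. D \<in> F \<and> - x \<in> D}"
    by simp
  also have "\<dots> = (\<lambda>D. D - {- x}) ` {D \<in> F. - x \<in> D}"
    by (simp add: setcompr_eq_image resolvent cong: image_cong_simp)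
  finally have "DP x F = (\<lambda>D. D - {- x}) ` {D \<in> F. - x \<in> D} \<union> {D \<in> F. x \<notin> D \<and> - x \<notin> D}"
    unfolding DP_def by simp
  also have "{D \<in> F. x \<notin> D \<and> - x \<notin> D} = (\<lambda>D. D - {- x}) ` {D \<in> F. x \<notin> D \<and> - x \<notin> D}"
    by (simp cong: image_cong_simp)
  also have "(\<lambda>D. D - {- x}) ` {D \<in> F. - x \<in> D} \<union> \<dots>
      = (\<lambda>D. D - {- x}) ` ({D \<in> F. - x \<in> D} \<union> {D \<in> F. x \<notin> D \<and> - x \<notin> D})"
    by (rule image_Un[symmetric])
  also have "{D \<in> F. - x \<in> D} \<union> {D \<in> F. x \<notin> D \<and> - x \<notin> D} = {D \<in> F. x \<notin> D}"
    using x_notin by blast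
  finally show ?thesis unfolding assign_def .
qed

lemma assign_uminus:
  assumes "unsat_hitting F" "x \<in> singular_literals F" "- x \<in> singular_literals F"
  shows "assign (- x) F = assign x F"
  using DP_uminus[of x F] assms by (simp add: DP_eq_assign)

lemma singular_DP_iff:
  assumes unsat: "unsat_hitting F"
  shows "singular_DP F G \<longleftrightarrow> (\<exists>x\<in>singular_literals F. G = assign x F)"
proof
  assume "singular_DP F G"
  then obtain v where "v \<in> singular_literals F \<or> - v \<in> singular_literals F" "G = DP v F"
    unfolding singular_DP_def singular_var_iff[OF unsat] by blast
  then show "\<exists>x\<in>singular_literals F. G = assign x F"
    using DP_eq_assign[OF unsat] DP_uminus by metis
next
  assume "\<exists>x\<in>singular_literals F. G = assign x F"
  then obtain x where x: "x \<in> singular_literals F" and "G = assign x F" by blast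
  then have "G = DP \<bar>x\<bar> F" by (simp add: DP_eq_assign[OF unsat] DP_uminus abs_if)
  then show "singular_DP F G"
    using singular_var_abs[OF unsat x] unfolding singular_DP_def by blast
qed

lemma nonsingular_iff_no_singular_DP: "nonsingular F \<longleftrightarrow> (\<nexists>G. singular_DP F G)"
  unfolding nonsingular_def singular_DP_def by blast

lemma unsat_hitting_singular_DP:
  assumes "unsat_hitting F" "singular_DP F G"
  shows "unsat_hitting G"
  using assms unsat_hitting_assign singular_DP_iff singular_literal_nonzero unsat_hittingD(1)
  by metis

lemma singular_literal_assign:
  assumes unsat: "unsat_hitting F"
    and x: "x \<in> singular_literals F" and y: "y \<in> singular_literals F"
    and "y \<noteq> x" "y \<noteq> - x"
  shows "y \<in> singular_literals (assign x F)"
proof -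
  obtain C where C: "C \<in> F" "x \<in> C" using x by (rule singular_literalE)
  then have "y \<notin> C" using singular_literals_clause_unique[OF unsat C] x y \<open>y \<noteq> x\<close> by blast
  then show ?thesis
    using ldeg_assign_outside_clause[OF unsat_hittingD[OF unsat] x C] y \<open>y \<noteq> - x\<close>
    unfolding singular_literals_def by simp
qed

lemma singular_DP_diamond:
  assumes unsat: "unsat_hitting F" and G: "singular_DP F G" and H: "singular_DP F H" and "G \<noteq> H"
  shows "\<exists>K. singular_DP G K \<and> singular_DP H K"
proof -
  obtain x where x: "x \<in> singular_literals F" "G = assign x F"
    using G singular_DP_iff[OF unsat] by blast
  obtain y where y: "y \<in> singular_literals F" "H = assign y F"
    using H singular_DP_iff[OF unsat] by blast
  have "x \<noteq> y" using x y \<open>G \<noteq> H\<close> by blast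
  have "x \<noteq> - y" using x y \<open>G \<noteq> H\<close> assign_uminus[OF unsat] by blast
  then have "y \<noteq> - x" by auto
  have "singular_DP G (assign y G)"
    using singular_literal_assign[OF unsat x(1) y(1)] \<open>x \<noteq> y\<close> \<open>y \<noteq> - x\<close> x(2)
      singular_DP_iff[OF unsat_hitting_singular_DP[OF unsat G]] by blast
  moreover have "singular_DP H (assign x H)"
    using singular_literal_assign[OF unsat y(1) x(1)] \<open>x \<noteq> y\<close> \<open>x \<noteq> - y\<close> y(2)
      singular_DP_iff[OF unsat_hitting_singular_DP[OF unsat H]] by blast
  moreover have "assign y G = assign x H"
    using assign_commute[OF \<open>y \<noteq> - x\<close>] x(2) y(2) by simp
  ultimately show ?thesis by auto
qed

lemma singind_eqI:
  assumes "unsat_hitting F" "(singular_DP ^^ n) F G" "nonsingular G"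
  shows "singind F = n"
proof -
  have "m = n" if "(singular_DP ^^ m) F H" "nonsingular H" for m H
    by (rule diamond_relpowp_length_unique[where P = unsat_hitting and r = singular_DP
          and x = F and y = H and z = G])
      (use unsat_hitting_singular_DP singular_DP_diamond nonsingular_iff_no_singular_DP that assms
        in blast)+
  then show ?thesis unfolding singind_def using assms(2,3) by (intro the_equality) blast+
qed

section \<open>The number of singular literals bounds the singularity index\<close>

lemma singular_literals_assign_outside_clause:
  assumes F: "clause_set F" "hitting F" and x: "x \<in> singular_literals F" and C: "C \<in> F" "x \<in> C"
  shows "singular_literals (assign x F) - C \<subseteq> singular_literals F - {x, - x}"
proof
  fix y assume y: "y \<in> singular_literals (assign x F) - C"
  then have "y \<notin> {x, - x}" using Union_assign_Int singular_literals_subset_Union by blast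
  moreover from this have "y \<in> singular_literals F"
    using y ldeg_assign_outside_clause[OF F x C, of y] unfolding singular_literals_def by simp
  ultimately show "y \<in> singular_literals F - {x, - x}" by blast
qed

lemma ldeg_uminus_le_ldeg_assign:
  assumes unsat: "unsat_hitting F" and x: "x \<in> singular_literals F"
    and C: "C \<in> F" "x \<in> C" and y: "y \<in> C" "y \<noteq> x"
  shows "ldeg F (- x) \<le> ldeg (assign x F) y"
proof -
  have "y \<noteq> - x" using y(1) C clause_uminus_notin unsat_hitting_clause[OF unsat] by blast
  have "{D \<in> F. - x \<in> D} \<subseteq> {D \<in> F. x \<notin> D \<and> y \<in> D}"
    using singular_clause_subset[OF unsat x C] y clause_uminus_notin unsat_hitting_clause[OF unsat]
    by blast
  then have "ldeg F (- x) \<le> card {D \<in> F. x \<notin> D \<and> y \<in> D}"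
    unfolding ldeg_def using unsat_hitting_finite[OF unsat] by (intro card_mono) auto
  also have "\<dots> = ldeg (assign x F) y"
    using ldeg_assign[OF unsat_hittingD[OF unsat] \<open>y \<noteq> - x\<close>] by simp
  finally show ?thesis .
qed

lemma singular_literals_assign_disjoint_clause:
  assumes unsat: "unsat_hitting F" and x: "x \<in> singular_literals F" "- x \<notin> singular_literals F"
    and C: "C \<in> F" "x \<in> C"
  shows "singular_literals (assign x F) \<inter> C = {}"
proof (rule equals0I)
  fix y assume y: "y \<in> singular_literals (assign x F) \<inter> C"
  then have "y \<noteq> x" using Union_assign_Int singular_literals_subset_Union by blast
  then have "ldeg F (- x) \<le> 1"
    using ldeg_uminus_le_ldeg_assign[OF unsat x(1) C] y unfolding singular_literals_def by force
  moreover have "ldeg F (- x) > 0"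
    using ldeg_pos_iff[OF unsat_hitting_finite[OF unsat]]
      unsat_hitting_uminus_mem_Union[OF unsat] C by blast
  ultimately show False using x(2) unfolding singular_literals_def by simp
qed

lemma card_singular_literals_assign_Int_clause_le:
  assumes unsat: "unsat_hitting F" and x: "x \<in> singular_literals F" "- x \<in> singular_literals F"
    and C: "C \<in> F" "x \<in> C"
  shows "card (singular_literals (assign x F) \<inter> C) \<le> 1"
proof -
  have "- x \<notin> C" using C clause_uminus_notin unsat_hitting_clause[OF unsat] by blast
  then have "C - {x} \<in> assign (- x) F" using C unfolding assign_def by auto
  then have "C - {x} \<in> assign x F" using assign_uminus[OF unsat x] by simp
  moreover have "unsat_hitting (assign x F)"
    using unsat_hitting_assign[OF unsat]
      singular_literal_nonzero[OF unsat_hittingD(1)[OF unsat] x(1)] by blast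
  ultimately have "card (singular_literals (assign x F) \<inter> (C - {x})) \<le> 1"
    using card_singular_literals_Int_clause_le by blast
  moreover have "singular_literals (assign x F) \<inter> C = singular_literals (assign x F) \<inter> (C - {x})"
    using Union_assign_Int singular_literals_subset_Union by blast
  ultimately show ?thesis by simp
qed

lemma card_singular_literals_assign_less:
  assumes unsat: "unsat_hitting F" and x: "x \<in> singular_literals F"
  shows "card (singular_literals (assign x F)) < card (singular_literals F)"
proof -
  define S where "S = singular_literals F"
  define T where "T = singular_literals (assign x F)"
  obtain C where C: "C \<in> F" "x \<in> C" using x by (rule singular_literalE)
  have fin: "finite S" and "x \<in> S"
    unfolding S_def using finite_singular_literals[OF unsat_hittingD(1)[OF unsat]] x by blast+
  have less: "card (S - {x}) < card S" using fin \<open>x \<in> S\<close> by (rule card_Diff1_less)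
  have "card T = card ((T - C) \<union> (T \<inter> C))" by (simp add: Un_Diff_Int)
  also have "\<dots> \<le> card (T - C) + card (T \<inter> C)" by (rule card_Un_le)
  also have "\<dots> \<le> card (S - {x, - x}) + card (T \<inter> C)"
    using fin
      card_mono[OF _ singular_literals_assign_outside_clause[OF unsat_hittingD[OF unsat] x C]]
    unfolding S_def T_def by simp
  also have "\<dots> < card S"
  proof (cases "- x \<in> S")
    case True
    then have "card (T \<inter> C) \<le> 1"
      unfolding S_def T_def
      using card_singular_literals_assign_Int_clause_le[OF unsat x _ C] by blast
    moreover have "- x \<in> S - {x}"
      using True singular_literal_nonzero[OF unsat_hittingD(1)[OF unsat] x] by simp
    then have "card (S - {x, - x}) < card (S - {x})"
      unfolding Diff_insert2[of S x "{- x}"] using fin by (intro card_Diff1_less) simp_all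
    ultimately show ?thesis using less by simp
  next
    case False
    then have "card (T \<inter> C) = 0"
      unfolding S_def T_def using singular_literals_assign_disjoint_clause[OF unsat x _ C] by simp
    moreover have "S - {x, - x} = S - {x}" using False by blast
    ultimately show ?thesis using less by simp
  qed
  finally show ?thesis unfolding S_def T_def .
qed

lemma singular_DP_normal_form:
  assumes "unsat_hitting F"
  shows "\<exists>n\<le>card (singular_literals F). \<exists>G. (singular_DP ^^ n) F G \<and> nonsingular G"
  using assms
proof (induction "card (singular_literals F)" arbitrary: F rule: less_induct)
  case less
  show ?case
  proof (cases "nonsingular F")
    case True
    then show ?thesis by (intro exI[of _ 0]) auto
  next
    case False
    then obtain x where x: "x \<in> singular_literals F" using nonsingular_iff[OF less.prems] by blast
    note smaller = card_singular_literals_assign_less[OF less.prems x]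
    have step: "singular_DP F (assign x F)" using x singular_DP_iff[OF less.prems] by blast
    then have "unsat_hitting (assign x F)" using unsat_hitting_singular_DP[OF less.prems] by blast
    then obtain n G where n: "n \<le> card (singular_literals (assign x F))"
      and G: "(singular_DP ^^ n) (assign x F) G" "nonsingular G"
      using less.hyps[OF smaller] by blast
    have "(singular_DP ^^ Suc n) F G" using step G(1) by (rule relpowp_Suc_I2)
    moreover have "Suc n \<le> card (singular_literals F)" using n smaller by simp
    ultimately show ?thesis using G(2) by blast
  qed
qed

lemma singind_le_card_singular_literals:
  assumes "unsat_hitting F"
  shows "singind F \<le> card (singular_literals F)"
  using singular_DP_normal_form[OF assms] singind_eqI[OF assms] by metis

section \<open>Full subsumption resolution\<close>

definition fs_resolve :: "int set \<Rightarrow> int \<Rightarrow> int set set \<Rightarrow> int set set" where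
  "fs_resolve E w F = insert E (F - fs_pair E w)"

lemma satisfiable_fs_resolveD:
  assumes "satisfiable (fs_resolve E w F)"
  shows "satisfiable F"
proof -
  obtain P where P: "clause P" "P \<inter> E \<noteq> {}" "\<forall>C\<in>F - fs_pair E w. P \<inter> C \<noteq> {}"
    using assms unfolding satisfiable_def fs_resolve_def by blast
  then have "\<forall>C\<in>F. P \<inter> C \<noteq> {}" unfolding fs_pair_def by blast
  then show ?thesis using P(1) unfolding satisfiable_def by blast
qed

lemma clause_set_fs_resolve: "clause_set F \<Longrightarrow> clause E \<Longrightarrow> clause_set (fs_resolve E w F)"
  unfolding clause_set_def fs_resolve_def by blast

lemma fs_pair_clash:
  assumes F: "clause_set F" "hitting F" and pair: "fs_pair E w \<subseteq> F" and B: "B \<in> F - fs_pair E w"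
  obtains x where "x \<in> B" "- x \<in> E"
proof -
  have "insert w E \<in> F" "insert (- w) E \<in> F" "B \<noteq> insert w E" "B \<noteq> insert (- w) E"
    using pair B unfolding fs_pair_def by auto
  then obtain l m where l: "l \<in> B" "- l \<in> insert w E" and m: "m \<in> B" "- m \<in> insert (- w) E"
    using hitting_clash[OF F(2)] B by (metis DiffD1)
  have "clause B" using F(1) B unfolding clause_set_def by blast
  then have "- l \<noteq> w \<or> - m \<noteq> - w" using l(1) m(1) clause_uminus_notin by fastforce
  then show thesis using that l m by blast
qed

lemma hitting_fs_resolve:
  assumes "clause_set F" "hitting F" "fs_pair E w \<subseteq> F"
  shows "hitting (fs_resolve E w F)"
proof -
  have clash: "\<exists>x\<in>B. - x \<in> E" if "B \<in> F - fs_pair E w" for B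
    using fs_pair_clash[OF assms that] by blast
  then have "\<exists>x\<in>E. - x \<in> B" if "B \<in> F - fs_pair E w" for B
    using that by (metis minus_minus)
  then show ?thesis
    using clash assms(2) unfolding hitting_def fs_resolve_def by blast
qed

lemma unsat_hitting_fs_resolve:
  assumes "unsat_hitting F" "clause E" "fs_pair E w \<subseteq> F"
  shows "unsat_hitting (fs_resolve E w F)"
  using assms satisfiable_fs_resolveD clause_set_fs_resolve hitting_fs_resolve
  unfolding unsat_hitting_def by blast

lemma singular_literals_fs_resolve:
  "singular_literals (fs_resolve E w F) - E \<subseteq> insert w (insert (- w) (singular_literals F))"
proof -
  have "{C \<in> fs_resolve E w F. y \<in> C} = {C \<in> F. y \<in> C}" if "y \<notin> E" "y \<noteq> w" "y \<noteq> - w" for y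
    using that unfolding fs_resolve_def fs_pair_def by blast
  then show ?thesis unfolding singular_literals_def ldeg_def by auto
qed

lemma card_singular_literals_fs_resolve_le:
  assumes unsat: "unsat_hitting F" and "clause E" "fs_pair E w \<subseteq> F"
  shows "card (singular_literals (fs_resolve E w F)) \<le> card (singular_literals F) + 3"
proof -
  define S where "S = singular_literals (fs_resolve E w F)"
  have "card (S \<inter> E) \<le> 1"
    unfolding S_def using unsat_hitting_fs_resolve[OF assms]
    by (rule card_singular_literals_Int_clause_le) (simp add: fs_resolve_def)
  moreover have "card (S - E) \<le> card (insert w (insert (- w) (singular_literals F)))"
    unfolding S_def using finite_singular_literals[OF unsat_hittingD(1)[OF unsat]]
      singular_literals_fs_resolve
    by (intro card_mono) simp
  moreover have "\<dots> \<le> card (singular_literals F) + 2"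
    using finite_singular_literals[OF unsat_hittingD(1)[OF unsat]] by (simp add: card_insert_if)
  moreover have "card S \<le> card (S - E) + card (S \<inter> E)"
    by (metis Un_Diff_Int card_Un_le)
  ultimately show ?thesis unfolding S_def by linarith
qed

theorem lemma8:
  fixes F F' :: "int set set"
  assumes "unsat_hitting F"
    and "nonsingular F"
    and "fs_resolvable F"
    and "fs_resolution F F'"
  shows "unsat_hitting F' \<and> singind F' \<le> 3"
proof
  obtain E w where E: "clause E" and pair: "fs_pair E w \<subseteq> F" and F': "F' = fs_resolve E w F"
    using assms(4) unfolding fs_resolution_def fs_resolvable_on_def fs_resolve_def by blast
  show unsat_F': "unsat_hitting F'"
    unfolding F' using unsat_hitting_fs_resolve[OF assms(1) E pair] .
  have "singind F' \<le> card (singular_literals F')"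
    using singind_le_card_singular_literals[OF unsat_F'] .
  also have "\<dots> \<le> card (singular_literals F) + 3"
    unfolding F' using card_singular_literals_fs_resolve_le[OF assms(1) E pair] .
  also have "\<dots> = 3" using assms(2) nonsingular_iff[OF assms(1)] by simp
  finally show "singind F' \<le> 3" .
qed

end
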